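(* Let $V:\mathfrak{C}\to\mathfrak{U}$ be a game value map, and let $v_T,w_\lambda\in\mathfrak{C}$ for all $\lambda,T>0$. Assume that the payoff family $v_T$ $(T>0)$ and the payoff family $w_\lambda$ $(\lambda>0)$ both enjoy the weak Dynamic Programming Principle. Then the following two statements are equivalent: (i) The family of functions $V[v_T]$ $(T>0)$ converges uniformly on $\Omega$ as $T\uparrow\infty$. (ii) The family of functions $V[w_\lambda]$ $(\lambda>0)$ converges uniformly on $\Omega$ as $\lambda\downarrow 0$. Moreover, when at least one of these statements holds, we have $$\lim_{T\uparrow\infty}V[v_T](\omega)=\lim_{\lambda\downarrow 0}V[w_\lambda](\omega)\qquad\forall\omega\in\Omega.$$
   Context: Setting: $\mathbb{R}_+=[0,\infty)$. $\Omega$ is a nonempty set; $\mathbb{K}$ is a nonempty set of maps from $\mathbb{R}_+$ to $\Omega$; $g:\Omega\to[0,1]$ is such that for every $z\in\mathbb{K}$ the map $t\mapsto g(z(t))$ is Borel measurable. For $T,\lambda>0$ and $z\in\mathbb{K}$, $$v_T(z)=\frac1T\int_0^T g(z(t))\,dt,\qquad w_\lambda(z)=\lambda\int_0^\infty e^{-\lambda t}g(z(t))\,dt .$$ Game value map: $\mathfrak{U}$ is the set of all bounded maps $\Omega\to\mathbb{R}$. $\mathfrak{C}$ is a nonempty set of maps $\mathbb{K}\to\mathbb{R}$ such that $Ac+B\in\mathfrak{C}$ for all $c\in\mathfrak{C}$, $A\ge0$, $B\in\mathbb{R}$. A map $V:\mathfrak{C}\to\mathfrak{U}$ is a game value map if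 (1) $V[Ac+B]=A\,V[c]+B$ for all $c\in\mathfrak{C}$, $A\ge 0$, $B\in\mathbb{R}$; and (2) for $c_1,c_2\in\mathfrak{C}$, if $c_1(z)\le c_2(z)$ for all $z\in\mathbb{K}$ then $V[c_1](\omega)\le V[c_2](\omega)$ for all $\omega\in\Omega$. Auxiliary payoffs: for $\lambda,T,h>0$ and $U_*:\Omega\to\mathbb{R}$, define for $z\in\mathbb{K}$ $$\zeta^{U_*}_{h,T}(z)=\frac{1}{T+h}\int_0^h g(z(t))\,dt+\frac{T}{T+h}U_*(z(h)),\qquad \xi^{U_*}_{h,\lambda}(z)=\lambda\int_0^h e^{-\lambda t}g(z(t))\,dt+e^{-\lambda h}U_*(z(h)).$$ Sub-/supersolutions: A family $U_T\in\mathfrak{U}$ $(T>0)$ is a subsolution (supersolution) for the payoffs $v_T$ $(T>0)$ if for every $\varepsilon>0$ there is a natural $\bar T$ such that for all natural $h,T>\bar T$ the payoff $\zeta^{U_T}_{h,T}$ lies in $\mathfrak{C}$ and $U_{T+h}\le V[\zeta^{U_T}_{h,T}]+\varepsilon$ (respectively $U_{T+h}\ge V[\zeta^{U_T}_{h,T}]-\varepsilon$) on $\Omega$. A family $U_\lambda\in\mathfrak{U}$ $(\lambda>0)$ is a subsolution (supersolution) for the payoffs $w_\lambda$ $(\lambda>0)$ if for every $\varepsilon>0$ there is a natural $\bar T$ such that for all natural $h>\bar T$ and all positive $\lambda<1/\bar T$ the payoff $\xi^{U_\lambda}_{h,\lambda}$ lies in $\mathfrak{C}$ and $U_\lambda\le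 V[\xi^{U_\lambda}_{h,\lambda}]+\varepsilon$ (respectively $U_\lambda\ge V[\xi^{U_\lambda}_{h,\lambda}]-\varepsilon$) on $\Omega$. Weak Dynamic Programming Principle: the family $v_T$ $(T>0)$ (resp. $w_\lambda$ $(\lambda>0)$) enjoys it iff the family of its value functions $V[v_T]$ $(T>0)$ (resp. $V[w_\lambda]$ $(\lambda>0)$) is both a subsolution and a supersolution for this payoff family. *)

theory Defs
  imports "HOL-Analysis.Analysis"
begin

(* Maps R_+ -> \<Omega>, K -> R and \<Omega> -> R are encoded as extensional functions (PiE), so that
   two maps that agree on their domain are equal. This matters because membership of a payoff in
   C is a hypothesis. *)

definition trajectory_class ::
    "'a set \<Rightarrow> ('a \<Rightarrow> real) \<Rightarrow> (real \<Rightarrow> 'a) set \<Rightarrow> bool" where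
  "trajectory_class \<Omega> g K \<longleftrightarrow>
     K \<noteq> {} \<and> K \<subseteq> {0..} \<rightarrow>\<^sub>E \<Omega> \<and>
     (\<forall>z\<in>K. (\<lambda>t. g (z t)) \<in> borel_measurable (restrict_space borel {0..}))"

definition bounded_maps :: "'a set \<Rightarrow> ('a \<Rightarrow> real) set" where
  "bounded_maps \<Omega> = {u \<in> \<Omega> \<rightarrow>\<^sub>E UNIV. bounded (u ` \<Omega>)}"

definition payoff_class ::
    "(real \<Rightarrow> 'a) set \<Rightarrow> ((real \<Rightarrow> 'a) \<Rightarrow> real) set \<Rightarrow> bool" where
  "payoff_class K C \<longleftrightarrow>
     C \<noteq> {} \<and> C \<subseteq> K \<rightarrow>\<^sub>E UNIV \<and>
     (\<forall>c\<in>C. \<forall>A\<ge>0. \<forall>B. (\<lambda>z\<in>K. A * c z + B) \<in> C)"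

definition game_value_map ::
    "'a set \<Rightarrow> (real \<Rightarrow> 'a) set \<Rightarrow> ((real \<Rightarrow> 'a) \<Rightarrow> real) set \<Rightarrow>
     (((real \<Rightarrow> 'a) \<Rightarrow> real) \<Rightarrow> 'a \<Rightarrow> real) \<Rightarrow> bool" where
  "game_value_map \<Omega> K C V \<longleftrightarrow>
     V \<in> C \<rightarrow> bounded_maps \<Omega> \<and>
     (\<forall>c\<in>C. \<forall>A\<ge>0. \<forall>B. \<forall>\<omega>\<in>\<Omega>. V (\<lambda>z\<in>K. A * c z + B) \<omega> = A * V c \<omega> + B) \<and>
     (\<forall>c1\<in>C. \<forall>c2\<in>C. (\<forall>z\<in>K. c1 z \<le> c2 z) \<longrightarrow> (\<forall>\<omega>\<in>\<Omega>. V c1 \<omega> \<le> V c2 \<omega>))"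

definition avg_payoff ::
    "(real \<Rightarrow> 'a) set \<Rightarrow> ('a \<Rightarrow> real) \<Rightarrow> real \<Rightarrow> (real \<Rightarrow> 'a) \<Rightarrow> real" where
  "avg_payoff K g T = (\<lambda>z\<in>K. 1 / T * (LINT t:{0..T}|lborel. g (z t)))"

definition disc_payoff ::
    "(real \<Rightarrow> 'a) set \<Rightarrow> ('a \<Rightarrow> real) \<Rightarrow> real \<Rightarrow> (real \<Rightarrow> 'a) \<Rightarrow> real" where
  "disc_payoff K g l = (\<lambda>z\<in>K. l * (LINT t:{0..}|lborel. exp (- l * t) * g (z t)))"

definition avg_aux_payoff ::
    "(real \<Rightarrow> 'a) set \<Rightarrow> ('a \<Rightarrow> real) \<Rightarrow> ('a \<Rightarrow> real) \<Rightarrow> real \<Rightarrow> real \<Rightarrow> (real \<Rightarrow> 'a) \<Rightarrow> real" where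
  "avg_aux_payoff K g u h T =
     (\<lambda>z\<in>K. 1 / (T + h) * (LINT t:{0..h}|lborel. g (z t)) + T / (T + h) * u (z h))"

definition disc_aux_payoff ::
    "(real \<Rightarrow> 'a) set \<Rightarrow> ('a \<Rightarrow> real) \<Rightarrow> ('a \<Rightarrow> real) \<Rightarrow> real \<Rightarrow> real \<Rightarrow> (real \<Rightarrow> 'a) \<Rightarrow> real" where
  "disc_aux_payoff K g u h l =
     (\<lambda>z\<in>K. l * (LINT t:{0..h}|lborel. exp (- l * t) * g (z t)) + exp (- l * h) * u (z h))"

definition avg_subsolution where
  "avg_subsolution \<Omega> g K C V (U :: real \<Rightarrow> 'a \<Rightarrow> real) \<longleftrightarrow>
     (\<forall>T>0. U T \<in> bounded_maps \<Omega>) \<and>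
     (\<forall>\<epsilon>>0. \<exists>N::nat. \<forall>(h::nat) (T::nat). h > N \<longrightarrow> T > N \<longrightarrow>
        avg_aux_payoff K g (U (real T)) (real h) (real T) \<in> C \<and>
        (\<forall>\<omega>\<in>\<Omega>. U (real T + real h) \<omega>
            \<le> V (avg_aux_payoff K g (U (real T)) (real h) (real T)) \<omega> + (\<epsilon>::real)))"

definition avg_supersolution where
  "avg_supersolution \<Omega> g K C V (U :: real \<Rightarrow> 'a \<Rightarrow> real) \<longleftrightarrow>
     (\<forall>T>0. U T \<in> bounded_maps \<Omega>) \<and>
     (\<forall>\<epsilon>>0. \<exists>N::nat. \<forall>(h::nat) (T::nat). h > N \<longrightarrow> T > N \<longrightarrow>
        avg_aux_payoff K g (U (real T)) (real h) (real T) \<in> C \<and>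
        (\<forall>\<omega>\<in>\<Omega>. U (real T + real h) \<omega>
            \<ge> V (avg_aux_payoff K g (U (real T)) (real h) (real T)) \<omega> - (\<epsilon>::real)))"

(* N > 0 below is essential: for N = 0 the bound 1 / real N would be 0 and the condition void. *)

definition disc_subsolution where
  "disc_subsolution \<Omega> g K C V (U :: real \<Rightarrow> 'a \<Rightarrow> real) \<longleftrightarrow>
     (\<forall>l>0. U l \<in> bounded_maps \<Omega>) \<and>
     (\<forall>\<epsilon>>0. \<exists>N::nat. N > 0 \<and> (\<forall>(h::nat) (l::real). h > N \<longrightarrow> 0 < l \<longrightarrow> l < 1 / real N \<longrightarrow>
        disc_aux_payoff K g (U l) (real h) l \<in> C \<and>
        (\<forall>\<omega>\<in>\<Omega>. U l \<omega> \<le> V (disc_aux_payoff K g (U l) (real h) l) \<omega> + (\<epsilon>::real))))"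

definition disc_supersolution where
  "disc_supersolution \<Omega> g K C V (U :: real \<Rightarrow> 'a \<Rightarrow> real) \<longleftrightarrow>
     (\<forall>l>0. U l \<in> bounded_maps \<Omega>) \<and>
     (\<forall>\<epsilon>>0. \<exists>N::nat. N > 0 \<and> (\<forall>(h::nat) (l::real). h > N \<longrightarrow> 0 < l \<longrightarrow> l < 1 / real N \<longrightarrow>
        disc_aux_payoff K g (U l) (real h) l \<in> C \<and>
        (\<forall>\<omega>\<in>\<Omega>. U l \<omega> \<ge> V (disc_aux_payoff K g (U l) (real h) l) \<omega> - (\<epsilon>::real))))"

definition avg_weak_DPP where
  "avg_weak_DPP \<Omega> g K C V \<longleftrightarrow>
     avg_subsolution \<Omega> g K C V (\<lambda>T. V (avg_payoff K g T)) \<and>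
     avg_supersolution \<Omega> g K C V (\<lambda>T. V (avg_payoff K g T))"

definition disc_weak_DPP where
  "disc_weak_DPP \<Omega> g K C V \<longleftrightarrow>
     disc_subsolution \<Omega> g K C V (\<lambda>l. V (disc_payoff K g l)) \<and>
     disc_supersolution \<Omega> g K C V (\<lambda>l. V (disc_payoff K g l))"

end

theory Submission
  imports Defs
begin

text \<open>Match the discount rate to the horizon, \<open>F s = V[v\<^sub>s]\<close> and \<open>G s = V[w\<^bsub>1/s\<^esub>]\<close>, and put
  \<open>s = T + h\<close>, \<open>\<delta> = h / s\<close>. Up to \<open>\<delta>\<^sup>2\<close> the two auxiliary payoffs are the same mixture of the
  average over \<open>[0, h]\<close> (weight \<open>\<delta>\<close>) and the continuation value (weight \<open>1 - \<delta>\<close>), so the dynamic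
  programming principles give \<open>|F s - G s| \<le> (1 - \<delta>) sup |F T - G s| + \<delta>\<^sup>2 + \<epsilon>\<close>. If either family
  converges uniformly, \<open>F T - G s\<close> may be replaced by \<open>F T - G T\<close> or \<open>F s - G s\<close> at small cost;
  iterating with \<open>\<epsilon>\<close> of order \<open>\<delta>\<^sup>2\<close> bounds \<open>|F - G|\<close> eventually by \<open>O(\<delta>)\<close>, along integers.
  Real arguments follow since \<open>F\<close> and \<open>G\<close> vary slowly.\<close>

section \<open>Kernel means of [0,1]-valued functions\<close>

lemma weighted_set_integral:
  fixes k f :: "'b \<Rightarrow> real"
  assumes k: "set_integrable M A k" "\<And>t. t \<in> A \<Longrightarrow> 0 \<le> k t"
    and f: "set_borel_measurable M A f" "\<And>t. t \<in> A \<Longrightarrow> f t \<in> {0..1}"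
  shows "set_integrable M A (\<lambda>t. k t * f t)"
    and "0 \<le> (LINT t:A|M. k t * f t)"
    and "(LINT t:A|M. k t * f t) \<le> (LINT t:A|M. k t)"
proof -
  have le: "\<bar>k t * f t\<bar> \<le> k t" "0 \<le> k t * f t" if "t \<in> A" for t
    using k(2)[OF that] f(2)[OF that] by (auto simp: abs_mult mult_left_le)
  have "(\<lambda>t. (indicator A t *\<^sub>R k t) * (indicator A t *\<^sub>R f t)) \<in> borel_measurable M"
    using k(1) f(1) unfolding set_integrable_def set_borel_measurable_def
    by (intro borel_measurable_times) auto
  also have "(\<lambda>t. (indicator A t *\<^sub>R k t) * (indicator A t *\<^sub>R f t)) =
      (\<lambda>t. indicator A t *\<^sub>R (k t * f t))"
    by (auto simp: indicator_def)
  finally have "set_borel_measurable M A (\<lambda>t. k t * f t)"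
    unfolding set_borel_measurable_def .
  then show int: "set_integrable M A (\<lambda>t. k t * f t)"
    using le k(2) by (intro set_integrable_bound[OF k(1)]) auto
  show "0 \<le> (LINT t:A|M. k t * f t)"
    unfolding set_lebesgue_integral_def using le
    by (intro Bochner_Integration.integral_nonneg) (auto simp: indicator_def)
  show "(LINT t:A|M. k t * f t) \<le> (LINT t:A|M. k t)"
    using le by (intro set_integral_mono int k(1)) (auto dest: abs_le_D1)
qed

text \<open>The kernel has mass \<open>s\<close> and grows with \<open>s\<close>, so the
  unnormalised integrals satisfy \<open>0 \<le> b - a \<le> s - r\<close>. The difference of the
  means is then \<open>(b - a) / s\<close> minus \<open>(a / r) * ((s - r) / s)\<close>, two numbers
  in the same interval from 0 to \<open>(s - r) / s\<close>. Averaging and discounting are both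
  instances.\<close>

lemma kernel_mean_diff:
  fixes k :: "real \<Rightarrow> 'b \<Rightarrow> real" and f :: "'b \<Rightarrow> real"
  assumes k: "\<And>s. s > 0 \<Longrightarrow> set_integrable M A (k s)" "\<And>s. s > 0 \<Longrightarrow> (LINT t:A|M. k s t) = s"
    and mono: "\<And>r s t. 0 < r \<Longrightarrow> r \<le> s \<Longrightarrow> t \<in> A \<Longrightarrow> 0 \<le> k r t \<and> k r t \<le> k s t"
    and f: "set_borel_measurable M A f" "\<And>t. t \<in> A \<Longrightarrow> f t \<in> {0..1}"
    and r: "0 < r" "r \<le> s"
  shows "\<bar>1 / s * (LINT t:A|M. k s t * f t) - 1 / r * (LINT t:A|M. k r t * f t)\<bar> \<le> (s - r) / s"
proof -
  have s: "s > 0" using r by simp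
  define a b where "a = (LINT t:A|M. k r t * f t)" and "b = (LINT t:A|M. k s t * f t)"
  note wr = weighted_set_integral[OF k(1)[OF r(1)] _ f, simplified k(2)[OF r(1)]]
  note ws = weighted_set_integral[OF k(1)[OF s] _ f]
  have nn: "0 \<le> k r t" "0 \<le> k s t" "k r t \<le> k s t" if "t \<in> A" for t
    using mono[OF r that] mono[OF s order_refl that] by auto
  have a: "0 \<le> a" "a \<le> r" and ir: "set_integrable M A (\<lambda>t. k r t * f t)"
    unfolding a_def using wr nn by auto
  have bs: "set_integrable M A (\<lambda>t. k s t * f t)" using ws nn by auto
  have "set_integrable M A (\<lambda>t. k s t - k r t)"
    using k(1) r s by auto
  note wd = weighted_set_integral[OF this _ f]
  have "(LINT t:A|M. (k s t - k r t) * f t) = b - a"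
    using bs ir by (simp add: a_def b_def left_diff_distrib)
  moreover have "(LINT t:A|M. k s t - k r t) = s - r"
    using k r s by simp
  ultimately have d: "0 \<le> b - a" "b - a \<le> s - r"
    using wd(2,3) nn by auto
  have ab: "1 / s * b - 1 / r * a = (b - a) / s - (a / r) * ((s - r) / s)"
    using r s by (simp add: field_simps)
  have "0 \<le> (b - a) / s" "(b - a) / s \<le> (s - r) / s"
    using d s by (auto intro: divide_right_mono)
  moreover have "0 \<le> a / r" "a / r \<le> 1" "0 \<le> (s - r) / s" using a r s by auto
  then have "0 \<le> (a / r) * ((s - r) / s)" "(a / r) * ((s - r) / s) \<le> (s - r) / s"
    using mult_nonneg_nonneg mult_left_le_one_le by blast+
  ultimately show ?thesis
    unfolding a_def[symmetric] b_def[symmetric] ab by linarith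
qed

lemma set_integrable_exp_kernel:
  fixes s :: real
  assumes "s > 0"
  shows "set_integrable lborel {0..} (\<lambda>t. exp (- (1 / s) * t))"
    and "(LINT t:{0..}|lborel. exp (- (1 / s) * t)) = s"
proof -
  have hi: "((\<lambda>t. exp (- (1 / s) * t)) has_integral s) {0..}"
    using has_integral_exp_minus_to_infinity[of "1 / s" 0] assms by simp
  have "(\<lambda>t. exp (- (1 / s) * t)) absolutely_integrable_on {0..}"
    using hi by (intro nonnegative_absolutely_integrable_1) auto
  \<comment> \<open>Absolute integrability refers to the completed measure; since the integrand is
    Borel measurable, it descends to \<open>lborel\<close>.\<close>
  then show int: "set_integrable lborel {0..} (\<lambda>t. exp (- (1 / s) * t))"
    unfolding set_integrable_def by (subst (asm) integrable_completion) auto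
  show "(LINT t:{0..}|lborel. exp (- (1 / s) * t)) = s"
    using set_borel_integral_eq_integral(2)[OF int] hi by (simp add: integral_unique)
qed

lemma set_integrable_interval_kernel:
  fixes s :: real
  assumes "s > 0"
  shows "set_integrable lborel {0..} (indicator {0..s} :: real \<Rightarrow> real)"
    and "(LINT t:{0..}|lborel. indicator {0..s} t) = s"
proof -
  have eq: "indicator {0..} t * indicator {0..s} t = (indicator {0..s} t :: real)" for t
    by (auto simp: indicator_def)
  show "set_integrable lborel {0..} (indicator {0..s} :: real \<Rightarrow> real)"
    unfolding set_integrable_def using assms by (simp add: eq)
  show "(LINT t:{0..}|lborel. indicator {0..s} t) = s"
    unfolding set_lebesgue_integral_def using assms by (simp add: eq)
qed

text \<open>Moves the dependence on \<open>s\<close> from the domain into the kernel, because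
  \<open>kernel_mean_diff\<close> works over one fixed domain.\<close>

lemma set_integral_interval_kernel:
  fixes f :: "real \<Rightarrow> real"
  shows "(LINT t:{0..s}|lborel. f t) = (LINT t:{0..}|lborel. indicator {0..s} t * f t)"
  unfolding set_lebesgue_integral_def
  by (intro Bochner_Integration.integral_cong) (auto simp: indicator_def)

section \<open>Comparison of the two auxiliary payoffs\<close>

lemma exp_minus_le_quadratic:
  fixes x :: real
  assumes "0 \<le> x"
  shows "exp (- x) \<le> 1 - x + x\<^sup>2"
proof -
  have "exp (- x) \<le> 1 / (1 + x)"
    using exp_ge_add_one_self[of x] assms by (simp add: exp_minus field_simps)
  \<comment> \<open>Here (1 + x)(1 - x + x^2) = 1 + x^3, which is at least 1.\<close>
  also have "1 / (1 + x) \<le> 1 - x + x\<^sup>2"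
    using assms by (simp add: field_simps power2_eq_square)
  finally show ?thesis .
qed

text \<open>At rate \<open>1 / (T + h)\<close> both running parts carry the same factor, so the
  difference is \<open>p - q + (1 - \<delta>) * (u - w)\<close>. The term \<open>p\<close> comes
  from replacing the discount factor by 1 on the running part, \<open>q\<close> from replacing
  exp(-\<delta>) by 1 - \<delta> in the terminal weight. Both lie between 0 and \<delta>^2, hence so
  does the absolute value of \<open>p - q\<close>. The second order matters: each iteration
  contracts only by 1 - \<delta>, so an error of order \<delta> would accumulate to a
  constant.\<close>

lemma aux_payoff_diff:
  fixes f :: "real \<Rightarrow> real"
  assumes f: "set_borel_measurable lborel {0..h} f" "\<And>t. t \<in> {0..h} \<Longrightarrow> f t \<in> {0..1}"
    and h: "h > 0" and T: "T > 0" and l: "l = 1 / (T + h)"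
    and w: "w \<in> {0..1}" and d: "\<bar>u - w\<bar> \<le> d"
  shows "\<bar>(1 / (T + h) * (LINT t:{0..h}|lborel. f t) + T / (T + h) * u) -
          (l * (LINT t:{0..h}|lborel. exp (- l * t) * f t) + exp (- l * h) * w)\<bar>
         \<le> T / (T + h) * d + (h / (T + h))\<^sup>2"
proof -
  define \<delta> where "\<delta> = h / (T + h)"
  have l0: "l > 0" using h T by (simp add: l)
  have lh: "l * h = \<delta>" and \<delta>: "0 \<le> \<delta>" "T / (T + h) = 1 - \<delta>" "\<delta> \<le> 1"
    using h T l by (auto simp: \<delta>_def field_simps)
  have "set_integrable lborel {0..h} (\<lambda>t. 1 - exp (- l * t))"
    by (intro borel_integrable_atLeastAtMost' continuous_intros)
  note w1 = weighted_set_integral[OF this _ f]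
  \<comment> \<open>The weight 1 yields integrability of \<open>f\<close> itself.\<close>
  have "set_integrable lborel {0..h} (\<lambda>t. 1::real)"
    by (intro borel_integrable_atLeastAtMost' continuous_intros)
  from weighted_set_integral(1)[OF this _ f]
  have "set_integrable lborel {0..h} f" by simp
  moreover have "set_integrable lborel {0..h} (\<lambda>t. exp (- l * t))"
    by (intro borel_integrable_atLeastAtMost' continuous_intros)
  from weighted_set_integral(1)[OF this _ f]
  have "set_integrable lborel {0..h} (\<lambda>t. exp (- l * t) * f t)" by simp
  ultimately have split: "(LINT t:{0..h}|lborel. (1 - exp (- l * t)) * f t) =
      (LINT t:{0..h}|lborel. f t) - (LINT t:{0..h}|lborel. exp (- l * t) * f t)"
    by (simp add: left_diff_distrib)
  have "(LINT t:{0..h}|lborel. 1 - exp (- l * t)) \<le> (LINT t:{0..h}|lborel. \<delta>)"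
  proof (intro set_integral_mono borel_integrable_atLeastAtMost' continuous_intros)
    fix t assume t: "t \<in> {0..h}"
    have "1 - exp (- l * t) \<le> l * t" using exp_ge_add_one_self[of "- l * t"] by simp
    also have "\<dots> \<le> \<delta>" using t l0 by (auto simp flip: lh intro: mult_left_mono)
    finally show "1 - exp (- l * t) \<le> \<delta>" .
  qed
  also have "\<dots> = \<delta> * h" using h by (simp add: set_lebesgue_integral_def)
  finally have I: "0 \<le> (LINT t:{0..h}|lborel. (1 - exp (- l * t)) * f t)"
    "(LINT t:{0..h}|lborel. (1 - exp (- l * t)) * f t) \<le> \<delta> * h"
    using w1(2,3) l0 by auto
  define p where "p = l * (LINT t:{0..h}|lborel. (1 - exp (- l * t)) * f t)"
  have p: "0 \<le> p" "p \<le> \<delta>\<^sup>2"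
    using I l0 mult_left_mono[OF I(2), of l] lh
    by (auto simp: p_def power2_eq_square mult.left_commute)
  define q where "q = (exp (- \<delta>) - (1 - \<delta>)) * w"
  have "0 \<le> exp (- \<delta>) - (1 - \<delta>)" "exp (- \<delta>) - (1 - \<delta>) \<le> \<delta>\<^sup>2"
    using exp_ge_add_one_self[of "- \<delta>"] exp_minus_le_quadratic[OF \<delta>(1)] by auto
  then have q: "0 \<le> q" "q \<le> \<delta>\<^sup>2"
    using w mult_mono[of "exp (- \<delta>) - (1 - \<delta>)" "\<delta>\<^sup>2" w 1] by (auto simp: q_def)
  have "\<bar>(1 - \<delta>) * (u - w)\<bar> \<le> (1 - \<delta>) * d"
    using \<delta> d by (auto simp: abs_mult intro: mult_left_mono)
  moreover have "(1 / (T + h) * (LINT t:{0..h}|lborel. f t) + T / (T + h) * u) -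
      (l * (LINT t:{0..h}|lborel. exp (- l * t) * f t) + exp (- l * h) * w)
      = p - q + (1 - \<delta>) * (u - w)"
    unfolding p_def q_def split \<delta>(2) using lh by (simp add: l[symmetric] algebra_simps)
  ultimately show ?thesis
    unfolding \<delta>(2) \<delta>_def[symmetric] using p q by linarith
qed

section \<open>Iteration of the coupled inequality\<close>

lemma uniform_limit_Cauchy_at_top:
  fixes F :: "real \<Rightarrow> 'a \<Rightarrow> real"
  assumes "uniform_limit X F L at_top" "\<epsilon> > 0"
  shows "\<exists>M. \<forall>s\<ge>M. \<forall>r\<ge>M. \<forall>x\<in>X. \<bar>F s x - F r x\<bar> \<le> \<epsilon>"
proof -
  have "\<forall>\<^sub>F s in at_top. \<forall>x\<in>X. dist (F s x) (L x) < \<epsilon> / 2"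
    using assms by (intro uniform_limitD) auto
  then obtain M where M: "\<And>s x. s \<ge> M \<Longrightarrow> x \<in> X \<Longrightarrow> \<bar>F s x - L x\<bar> < \<epsilon> / 2"
    by (auto simp: eventually_at_top_linorder dist_real_def)
  have "\<bar>F s x - F r x\<bar> \<le> \<epsilon>" if "s \<ge> M" "r \<ge> M" "x \<in> X" for s r x
    using M[OF that(1,3)] M[OF that(2,3)] by linarith
  then show ?thesis by blast
qed

text \<open>The step is \<open>h = s div q\<close>, so that \<open>\<delta> = h / s\<close> lies between \<open>1 / (2 * q)\<close> and \<open>1 / q\<close>;
  with \<open>\<epsilon> = 1 / q\<^sup>2\<close>, the fixed point of \<open>b \<mapsto> (1 - 1 / (2 * q)) * b + 3 / q\<^sup>2\<close> is \<open>6 / q\<close>.\<close>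

lemma coupled_families_iterate:
  fixes F G :: "real \<Rightarrow> 'a \<Rightarrow> real"
  assumes conv: "uniform_limit X F L at_top \<or> uniform_limit X G L at_top"
    and unit: "\<And>s x. s > 0 \<Longrightarrow> x \<in> X \<Longrightarrow> F s x \<in> {0..1} \<and> G s x \<in> {0..1}"
    and couple: "\<And>\<epsilon>. \<epsilon> > 0 \<Longrightarrow> \<exists>N. \<forall>(h::nat) (T::nat) d. h > N \<longrightarrow> T > N \<longrightarrow>
        (\<forall>x\<in>X. \<bar>F (real T) x - G (real T + real h) x\<bar> \<le> d) \<longrightarrow>
        (\<forall>x\<in>X. \<bar>F (real T + real h) x - G (real T + real h) x\<bar>
            \<le> real T / (real T + real h) * d + (real h / (real T + real h))\<^sup>2 + \<epsilon>)"
    and q: "(q::nat) \<ge> 2"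
  shows "\<exists>M. \<forall>s\<ge>M. \<forall>x\<in>X. \<bar>F (real s) x - G (real s) x\<bar> \<le> (1 - 1 / (2 * real q)) ^ n + 6 / real q"
proof (induction n)
  case 0
  have "\<bar>F (real s) x - G (real s) x\<bar> \<le> 1 + 6 / real q" if "s \<ge> 1" "x \<in> X" for s x
  proof -
    have "\<bar>F (real s) x - G (real s) x\<bar> \<le> 1" using unit[of "real s" x] that by auto
    moreover have "0 \<le> 6 / real q" by simp
    ultimately show ?thesis by linarith
  qed
  then show ?case by auto
next
  case (Suc n)
  define b where "b = (1 - 1 / (2 * real q)) ^ n + 6 / real q"
  define \<epsilon> where "\<epsilon> = 1 / (real q)\<^sup>2"
  have \<epsilon>: "\<epsilon> > 0" using q by (simp add: \<epsilon>_def)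
  have r: "0 \<le> 1 - 1 / (2 * real q)" using q by (simp add: field_simps)
  have b: "0 \<le> b" unfolding b_def using r by (intro add_nonneg_nonneg zero_le_power) auto
  obtain M1 where M1: "\<And>s x. s \<ge> M1 \<Longrightarrow> x \<in> X \<Longrightarrow> \<bar>F (real s) x - G (real s) x\<bar> \<le> b"
    using Suc unfolding b_def by auto
  obtain M2 where M2: "(\<forall>s\<ge>M2. \<forall>r\<ge>M2. \<forall>x\<in>X. \<bar>F s x - F r x\<bar> \<le> \<epsilon>) \<or>
      (\<forall>s\<ge>M2. \<forall>r\<ge>M2. \<forall>x\<in>X. \<bar>G s x - G r x\<bar> \<le> \<epsilon>)"
    using conv by (elim disjE; use uniform_limit_Cauchy_at_top[OF _ \<epsilon>] in blast)
  obtain N where N: "\<And>h T d x. h > N \<Longrightarrow> T > N \<Longrightarrow>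
        (\<forall>x\<in>X. \<bar>F (real T) x - G (real T + real h) x\<bar> \<le> d) \<Longrightarrow> x \<in> X \<Longrightarrow>
        \<bar>F (real T + real h) x - G (real T + real h) x\<bar>
            \<le> real T / (real T + real h) * d + (real h / (real T + real h))\<^sup>2 + \<epsilon>"
    using couple[OF \<epsilon>] by blast
  \<comment> \<open>For \<open>s \<ge> M\<close> the step \<open>s div q\<close> is at least the
    bracket and so clears all thresholds at once. The final 1 makes \<open>h > N\<close> strict and
    \<open>h\<close> positive.\<close>
  define M where "M = q * (N + M1 + nat \<lceil>M2\<rceil> + 1)"
  have "\<bar>F (real s) x - G (real s) x\<bar> \<le> (1 - 1 / (2 * real q)) ^ Suc n + 6 / real q"
    if s: "s \<ge> M" and x: "x \<in> X" for s x
  proof -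
    define h where "h = s div q"
    define T where "T = s - h"
    have hM: "h \<ge> N + M1 + nat \<lceil>M2\<rceil> + 1"
      unfolding h_def using s q by (simp add: M_def less_eq_div_iff_mult_less_eq mult.commute)
    have hq: "q * h \<le> s" "s < q * (h + 1)"
      unfolding h_def using q dividend_less_div_times[of q s] by (auto simp: algebra_simps)
    \<comment> \<open>This is where \<open>q \<ge> 2\<close> enters: it gives
      \<open>T \<ge> h\<close>, so \<open>T\<close> clears the thresholds as well.\<close>
    have "2 * h \<le> q * h" using q by simp
    then have hs: "2 * h \<le> s" using hq by linarith
    then have T: "T \<ge> h" "T + h = s" by (auto simp: T_def)
    have Ts: "real T + real h = real s" using T(2) by (metis of_nat_add)
    have s0: "real s > 0" using hM hs by linarith
    define \<delta> where "\<delta> = real h / real s"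
    have Td: "real T / (real T + real h) = 1 - \<delta>" "real h / (real T + real h) = \<delta>"
      using Ts s0 by (auto simp: \<delta>_def field_simps)
    \<comment> \<open>Rounding in \<open>s div q\<close> costs at most a factor 2, as
      \<open>h + 1 \<le> 2 * h\<close>; hence the lower bound \<open>1 / (2 * real q)\<close> for
      \<delta>.\<close>
    have "s \<le> q * (2 * h)"
    proof -
      have "q * (h + 1) \<le> q * (2 * h)" using hM by (intro mult_le_mono2) linarith
      then show ?thesis using hq by linarith
    qed
    then have "real s \<le> real (q * (2 * h))" "real (q * h) \<le> real s"
      using hq(1) by (simp_all only: of_nat_le_iff)
    then have d: "1 / (2 * real q) \<le> \<delta>" "\<delta> \<le> 1 / real q"
      using s0 q by (auto simp: \<delta>_def field_simps)
    have "1 / real q \<le> 1" using q by simp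
    then have d1: "\<delta> \<le> 1" "0 \<le> \<delta>" using d by (auto simp: \<delta>_def)
    have big: "T \<ge> M1" "s \<ge> M1" "real T \<ge> M2" "real s \<ge> M2"
      using T hM hs by linarith+
    have "\<bar>F (real T) y - G (real T + real h) y\<bar> \<le> b + \<epsilon>" if y: "y \<in> X" for y
    proof -
      \<comment> \<open>If \<open>F\<close> varies by at most \<epsilon>, compare with the gap at
        \<open>s\<close>; if \<open>G\<close> does, with the gap at \<open>T\<close>. The induction
        hypothesis bounds both gaps by \<open>b\<close>.\<close>
      have "\<bar>F (real T) y - F (real s) y\<bar> \<le> \<epsilon> \<or> \<bar>G (real T) y - G (real s) y\<bar> \<le> \<epsilon>"
        using M2 big y by blast
      then show ?thesis
        using M1[OF big(1) y] M1[OF big(2) y] unfolding Ts by linarith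
    qed
    then have "\<forall>y\<in>X. \<bar>F (real T) y - G (real T + real h) y\<bar> \<le> b + \<epsilon>" by blast
    moreover have "h > N" "T > N" using hM T(1) by linarith+
    ultimately have "\<bar>F (real s) x - G (real s) x\<bar> \<le> (1 - \<delta>) * (b + \<epsilon>) + \<delta>\<^sup>2 + \<epsilon>"
      using N[of h T "b + \<epsilon>" x] x unfolding Td unfolding Ts by blast
    also have "(1 - \<delta>) * (b + \<epsilon>) \<le> (1 - \<delta>) * b + \<epsilon>"
      using d1 \<epsilon> by (simp add: algebra_simps)
    also have "(1 - \<delta>) * b \<le> (1 - 1 / (2 * real q)) * b"
      using d b by (intro mult_right_mono) auto
    also have "\<delta>\<^sup>2 \<le> \<epsilon>"
      using power_mono[OF d(2) d1(2), of 2] by (simp add: \<epsilon>_def power_divide)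
    \<comment> \<open>The three \<epsilon> come from the Cauchy bound, from \<delta>^2 and from
      \<open>couple\<close>. Together they equal 3/q^2, exactly what the summand
      \<open>6 / real q\<close> of \<open>b\<close> loses under the contraction.\<close>
    also have "(1 - 1 / (2 * real q)) * b + \<epsilon> + \<epsilon> + \<epsilon> = (1 - 1 / (2 * real q)) ^ Suc n + 6 / real q"
      using q by (simp add: b_def \<epsilon>_def field_simps power2_eq_square)
    finally show ?thesis by simp
  qed
  then show ?case by blast
qed

text \<open>First \<open>q\<close> makes \<open>6 / real q\<close> less than \<open>e / 4\<close>,
  then \<open>n\<close>, depending on \<open>q\<close>, does the same for the geometric term. The
  remaining \<open>e / 2\<close> pays for moving both \<open>F\<close> and \<open>G\<close> from a
  real \<open>s\<close> to its integer part.\<close>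

lemma coupled_families_uniformly_close:
  fixes F G :: "real \<Rightarrow> 'a \<Rightarrow> real"
  assumes conv: "uniform_limit X F L at_top \<or> uniform_limit X G L at_top"
    and unit: "\<And>s x. s > 0 \<Longrightarrow> x \<in> X \<Longrightarrow> F s x \<in> {0..1} \<and> G s x \<in> {0..1}"
    and slow: "\<And>r s x. 0 < r \<Longrightarrow> r \<le> s \<Longrightarrow> x \<in> X \<Longrightarrow>
        \<bar>F s x - F r x\<bar> \<le> (s - r) / s \<and> \<bar>G s x - G r x\<bar> \<le> (s - r) / s"
    and couple: "\<And>\<epsilon>. \<epsilon> > 0 \<Longrightarrow> \<exists>N. \<forall>(h::nat) (T::nat) d. h > N \<longrightarrow> T > N \<longrightarrow>
        (\<forall>x\<in>X. \<bar>F (real T) x - G (real T + real h) x\<bar> \<le> d) \<longrightarrow>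
        (\<forall>x\<in>X. \<bar>F (real T + real h) x - G (real T + real h) x\<bar>
            \<le> real T / (real T + real h) * d + (real h / (real T + real h))\<^sup>2 + \<epsilon>)"
  shows "uniform_limit X (\<lambda>s x. F s x - G s x) (\<lambda>x. 0) at_top"
proof (rule uniform_limitI)
  fix e :: real assume e: "e > 0"
  obtain q0 :: nat where q0: "real q0 > 24 / e" using reals_Archimedean2 by blast
  define q where "q = q0 + 2"
  have q: "q \<ge> 2" "real q > 24 / e" using q0 by (auto simp: q_def)
  then have qe: "6 / real q < e / 4" using e by (auto simp: field_simps)
  have "0 \<le> 1 - 1 / (2 * real q)" "1 - 1 / (2 * real q) < 1" using q(1) by (auto simp: field_simps)
  then obtain n where n: "(1 - 1 / (2 * real q)) ^ n < e / 4"
    using real_arch_pow_inv[of "e / 4" "1 - 1 / (2 * real q)"] e by auto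
  obtain M where M: "\<And>s x. s \<ge> M \<Longrightarrow> x \<in> X \<Longrightarrow>
      \<bar>F (real s) x - G (real s) x\<bar> \<le> (1 - 1 / (2 * real q)) ^ n + 6 / real q"
    using coupled_families_iterate[OF conv unit couple q(1), of n] by blast
  \<comment> \<open>The bound \<open>real M + 1\<close> puts the integer part of \<open>s\<close>
    above \<open>M\<close>; the bound \<open>4 / e\<close> makes the rounding error
    \<open>1 / s\<close> at most \<open>e / 4\<close>.\<close>
  have "dist (F s x - G s x) 0 < e" if s: "s \<ge> max (real M + 1) (4 / e)" and x: "x \<in> X" for s x
  proof -
    define m where "m = nat \<lfloor>s\<rfloor>"
    have m: "m \<ge> M" "real m > 0" "real m \<le> s" "s - real m \<le> 1" and s0: "s > 0"
      using s unfolding m_def by linarith+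
    have "(s - real m) / s \<le> 1 / s" using m(4) s0 by (intro divide_right_mono) auto
    also have "1 / s \<le> e / 4" using s s0 e by (auto simp: field_simps)
    finally have "\<bar>F s x - F m x\<bar> \<le> e / 4" "\<bar>G s x - G m x\<bar> \<le> e / 4"
      using slow[OF m(2,3) x] by (blast intro: order_trans)+
    then show ?thesis
      using M[OF m(1) x] n qe unfolding dist_real_def by linarith
  qed
  then show "\<forall>\<^sub>F s in at_top. \<forall>x\<in>X. dist (F s x - G s x) 0 < e"
    unfolding eventually_at_top_linorder by blast
qed

section \<open>Nonexpansiveness of the value map\<close>

text \<open>A monotone map that commutes with adding constants is nonexpansive in the sup norm.
  Closure of \<open>C\<close> under affine maps, taken with factor 1, keeps the shifted payoff
  admissible.\<close>

lemma game_value_diff: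
  assumes V: "game_value_map \<Omega> K C V" and C: "payoff_class K C"
    and c: "c1 \<in> C" "c2 \<in> C" and diff: "\<And>z. z \<in> K \<Longrightarrow> \<bar>c1 z - c2 z\<bar> \<le> e" and \<omega>: "\<omega> \<in> \<Omega>"
  shows "\<bar>V c1 \<omega> - V c2 \<omega>\<bar> \<le> e"
proof -
  have "V c \<omega> \<le> V c' \<omega> + e" if cc: "c \<in> C" "c' \<in> C" "\<And>z. z \<in> K \<Longrightarrow> c z \<le> c' z + e" for c c'
  proof -
    have "(\<lambda>z\<in>K. 1 * c' z + e) \<in> C"
      using C cc(2) unfolding payoff_class_def by (blast intro: zero_le_one)
    then have "V c \<omega> \<le> V (\<lambda>z\<in>K. 1 * c' z + e) \<omega>"
      using V cc \<omega> unfolding game_value_map_def by auto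
    also have "\<dots> = 1 * V c' \<omega> + e"
      using V cc(2) \<omega> unfolding game_value_map_def by (blast intro: zero_le_one)
    finally show ?thesis by simp
  qed
  from this[of c1 c2] this[of c2 c1] show ?thesis
    using c diff by (smt (verit))
qed

text \<open>The factor 0 applied to \<open>c\<close> puts the constant payoff 1/2 into
  \<open>C\<close>, with value 1/2. A payoff in [0,1] is within 1/2 of it, and nonexpansiveness
  transfers this to the values.\<close>

lemma game_value_unit:
  assumes V: "game_value_map \<Omega> K C V" and C: "payoff_class K C"
    and c: "c \<in> C" "\<And>z. z \<in> K \<Longrightarrow> c z \<in> {0..1}" and \<omega>: "\<omega> \<in> \<Omega>"
  shows "V c \<omega> \<in> {0..1}"
proof -
  define k where "k = (\<lambda>z\<in>K. 0 * c z + (1 / 2 :: real))"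
  have k: "k \<in> C" using C c(1) unfolding k_def payoff_class_def by blast
  have "V k \<omega> = 0 * V c \<omega> + 1 / 2"
    using V c(1) \<omega> unfolding k_def game_value_map_def by blast
  moreover have "\<bar>V c \<omega> - V k \<omega>\<bar> \<le> 1 / 2"
  proof (rule game_value_diff[OF V C c(1) k _ \<omega>])
    show "\<bar>c z - k z\<bar> \<le> 1 / 2" if "z \<in> K" for z
    proof -
      have "k z = 1 / 2" using that by (simp add: k_def)
      then show ?thesis using c(2)[OF that] unfolding atLeastAtMost_iff by linarith
    qed
  qed
  ultimately show ?thesis unfolding atLeastAtMost_iff by linarith
qed

section \<open>Averaged and discounted payoffs along trajectories\<close>

context
  fixes \<Omega> :: "'a set" and g :: "'a \<Rightarrow> real" and K :: "(real \<Rightarrow> 'a) set"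
  assumes g: "g \<in> \<Omega> \<rightarrow> {0..1}" and K: "trajectory_class \<Omega> g K"
begin

lemma trajectory_in_states: "z \<in> K \<Longrightarrow> t \<ge> 0 \<Longrightarrow> z t \<in> \<Omega>"
  using K by (auto simp: trajectory_class_def PiE_def Pi_def)

lemma running_payoff_unit: "z \<in> K \<Longrightarrow> t \<ge> 0 \<Longrightarrow> g (z t) \<in> {0..1}"
  using trajectory_in_states g by blast

text \<open>Measurability is given only on the half-line, and \<open>z t\<close> is
  \<open>undefined\<close> for negative \<open>t\<close>. The indicator of \<open>{0..}\<close>
  produces a Borel function on the whole line, and the indicator of the smaller set \<open>s\<close>
  then absorbs it.\<close>

lemma running_payoff_measurable:
  assumes "z \<in> K" "s \<in> sets borel" "s \<subseteq> {0..}"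
  shows "set_borel_measurable lborel s (\<lambda>t. g (z t))"
proof -
  have "(\<lambda>t. g (z t)) \<in> borel_measurable (restrict_space borel {0..})"
    using K assms(1) by (simp add: trajectory_class_def)
  then have "(\<lambda>t. indicator {0..} t *\<^sub>R g (z t)) \<in> borel_measurable borel"
    by (subst (asm) borel_measurable_restrict_space_iff) auto
  then have "(\<lambda>t. indicator s t *\<^sub>R (indicator {0..} t *\<^sub>R g (z t))) \<in> borel_measurable borel"
    using assms(2) by (rule borel_measurable_scaleR[OF borel_measurable_indicator, rotated])
  also have "(\<lambda>t. indicator s t *\<^sub>R (indicator {0..} t *\<^sub>R g (z t))) = (\<lambda>t. indicator s t *\<^sub>R g (z t))"
    using assms(3) by (auto simp: indicator_def fun_eq_iff)
  finally show ?thesis by (simp add: set_borel_measurable_def)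
qed

lemma avg_payoff_kernel:
  "z \<in> K \<Longrightarrow> avg_payoff K g s z = 1 / s * (LINT t:{0..}|lborel. indicator {0..s} t * g (z t))"
  by (simp add: avg_payoff_def set_integral_interval_kernel)

text \<open>Rate \<open>1 / s\<close> gives discounting the shape of averaging over
  \<open>{0..s}\<close>: prefactor \<open>1 / s\<close> and a kernel of mass \<open>s\<close> that
  increases with \<open>s\<close>.\<close>

lemma disc_payoff_kernel:
  "z \<in> K \<Longrightarrow> disc_payoff K g (1 / s) z = 1 / s * (LINT t:{0..}|lborel. exp (- (1 / s) * t) * g (z t))"
  by (simp add: disc_payoff_def)

lemma avg_payoff_unit:
  assumes z: "z \<in> K" and s: "s > 0"
  shows "avg_payoff K g s z \<in> {0..1}"
proof -
  note f = running_payoff_measurable[OF z] running_payoff_unit[OF z]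
  note w = weighted_set_integral[OF set_integrable_interval_kernel(1)[OF s] _ f]
  have "0 \<le> (LINT t:{0..}|lborel. indicator {0..s} t * g (z t))"
    "(LINT t:{0..}|lborel. indicator {0..s} t * g (z t)) \<le> s"
    using w(2,3) unfolding set_integrable_interval_kernel(2)[OF s] by auto
  then show ?thesis using s unfolding avg_payoff_kernel[OF z] by auto
qed

lemma disc_payoff_unit:
  assumes z: "z \<in> K" and s: "s > 0"
  shows "disc_payoff K g (1 / s) z \<in> {0..1}"
proof -
  note f = running_payoff_measurable[OF z] running_payoff_unit[OF z]
  note w = weighted_set_integral[OF set_integrable_exp_kernel(1)[OF s] _ f]
  have "0 \<le> (LINT t:{0..}|lborel. exp (- (1 / s) * t) * g (z t))"
    "(LINT t:{0..}|lborel. exp (- (1 / s) * t) * g (z t)) \<le> s"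
    using w(2,3) unfolding set_integrable_exp_kernel(2)[OF s] by auto
  then show ?thesis using s unfolding disc_payoff_kernel[OF z] by auto
qed

lemma avg_payoff_slow:
  assumes z: "z \<in> K" and r: "0 < r" "r \<le> s"
  shows "\<bar>avg_payoff K g s z - avg_payoff K g r z\<bar> \<le> (s - r) / s"
  unfolding avg_payoff_kernel[OF z]
  by (rule kernel_mean_diff[where k = "\<lambda>s. indicator {0..s}"])
    (use r set_integrable_interval_kernel running_payoff_measurable[OF z] running_payoff_unit[OF z]
      in \<open>auto simp: indicator_def\<close>)

lemma disc_payoff_slow:
  assumes z: "z \<in> K" and r: "0 < r" "r \<le> s"
  shows "\<bar>disc_payoff K g (1 / s) z - disc_payoff K g (1 / r) z\<bar> \<le> (s - r) / s"
  unfolding disc_payoff_kernel[OF z]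
proof (rule kernel_mean_diff[where k = "\<lambda>s t. exp (- (1 / s) * t)"])
  show "0 \<le> exp (- (1 / a) * t) \<and> exp (- (1 / a) * t) \<le> exp (- (1 / b) * t)"
    if "0 < a" "a \<le> b" "t \<in> {0..}" for a b t :: real
    using that by (auto intro!: divide_left_mono)
qed (use r set_integrable_exp_kernel running_payoff_measurable[OF z] running_payoff_unit[OF z]
      in auto)

lemma aux_payoffs_close:
  assumes z: "z \<in> K" and h: "h > 0" and T: "T > 0"
    and W: "\<And>\<omega>. \<omega> \<in> \<Omega> \<Longrightarrow> W \<omega> \<in> {0..1}" and d: "\<And>\<omega>. \<omega> \<in> \<Omega> \<Longrightarrow> \<bar>U \<omega> - W \<omega>\<bar> \<le> d"
  shows "\<bar>avg_aux_payoff K g U h T z - disc_aux_payoff K g W h (1 / (T + h)) z\<bar>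
      \<le> T / (T + h) * d + (h / (T + h))\<^sup>2"
proof -
  have zh: "z h \<in> \<Omega>" using trajectory_in_states[OF z] h by simp
  show ?thesis
    using aux_payoff_diff[of h "\<lambda>t. g (z t)" T "1 / (T + h)" "W (z h)" "U (z h)" d]
      running_payoff_measurable[OF z, of "{0..h}"] running_payoff_unit[OF z] W[OF zh] d[OF zh] h T z
    by (auto simp: avg_aux_payoff_def disc_aux_payoff_def)
qed

section \<open>Coupling by the dynamic programming principles\<close>

text \<open>Each principle replaces a value at \<open>s\<close> by that of an auxiliary payoff, at
  cost \<open>\<epsilon> / 2\<close>; nonexpansiveness then reduces the claim to
  \<open>aux_payoffs_close\<close>. The averaged principle shortens the horizon from
  \<open>T + h\<close> to \<open>T\<close>, while the discounted one keeps its rate. This is why the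
  hypothesis compares \<open>F\<close> at \<open>T\<close> with \<open>G\<close> at
  \<open>T + h\<close>.\<close>

lemma DPP_coupling:
  assumes C: "payoff_class K C" and V: "game_value_map \<Omega> K C V"
    and dC: "\<And>l. l > 0 \<Longrightarrow> disc_payoff K g l \<in> C"
    and avg: "avg_weak_DPP \<Omega> g K C V" and disc: "disc_weak_DPP \<Omega> g K C V"
    and \<epsilon>: "(\<epsilon>::real) > 0"
  defines "F \<equiv> \<lambda>s. V (avg_payoff K g s)" and "G \<equiv> \<lambda>s. V (disc_payoff K g (1 / s))"
  shows "\<exists>N. \<forall>(h::nat) (T::nat) d. h > N \<longrightarrow> T > N \<longrightarrow>
        (\<forall>\<omega>\<in>\<Omega>. \<bar>F (real T) \<omega> - G (real T + real h) \<omega>\<bar> \<le> d) \<longrightarrow>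
        (\<forall>\<omega>\<in>\<Omega>. \<bar>F (real T + real h) \<omega> - G (real T + real h) \<omega>\<bar>
            \<le> real T / (real T + real h) * d + (real h / (real T + real h))\<^sup>2 + \<epsilon>)"
proof -
  have \<epsilon>2: "\<epsilon> / 2 > 0" using \<epsilon> by simp
  obtain N1 where N1: "\<forall>(h::nat) (T::nat). h > N1 \<longrightarrow> T > N1 \<longrightarrow>
      avg_aux_payoff K g (F (real T)) (real h) (real T) \<in> C \<and>
      (\<forall>\<omega>\<in>\<Omega>. F (real T + real h) \<omega> \<le> V (avg_aux_payoff K g (F (real T)) (real h) (real T)) \<omega> + \<epsilon> / 2)"
    using avg \<epsilon>2 unfolding avg_weak_DPP_def avg_subsolution_def F_def by blast
  obtain N2 where N2: "\<forall>(h::nat) (T::nat). h > N2 \<longrightarrow> T > N2 \<longrightarrow>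
      avg_aux_payoff K g (F (real T)) (real h) (real T) \<in> C \<and>
      (\<forall>\<omega>\<in>\<Omega>. F (real T + real h) \<omega> \<ge> V (avg_aux_payoff K g (F (real T)) (real h) (real T)) \<omega> - \<epsilon> / 2)"
    using avg \<epsilon>2 unfolding avg_weak_DPP_def avg_supersolution_def F_def by blast
  obtain N3 :: nat where N3: "N3 > 0" "\<forall>(h::nat) l. h > N3 \<longrightarrow> 0 < l \<longrightarrow> l < 1 / real N3 \<longrightarrow>
      disc_aux_payoff K g (V (disc_payoff K g l)) (real h) l \<in> C \<and>
      (\<forall>\<omega>\<in>\<Omega>. V (disc_payoff K g l) \<omega> \<le> V (disc_aux_payoff K g (V (disc_payoff K g l)) (real h) l) \<omega> + \<epsilon> / 2)"
    using disc \<epsilon>2 unfolding disc_weak_DPP_def disc_subsolution_def by blast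
  obtain N4 :: nat where N4: "N4 > 0" "\<forall>(h::nat) l. h > N4 \<longrightarrow> 0 < l \<longrightarrow> l < 1 / real N4 \<longrightarrow>
      disc_aux_payoff K g (V (disc_payoff K g l)) (real h) l \<in> C \<and>
      (\<forall>\<omega>\<in>\<Omega>. V (disc_payoff K g l) \<omega> \<ge> V (disc_aux_payoff K g (V (disc_payoff K g l)) (real h) l) \<omega> - \<epsilon> / 2)"
    using disc \<epsilon>2 unfolding disc_weak_DPP_def disc_supersolution_def by blast
  have "\<bar>F (real T + real h) \<omega> - G (real T + real h) \<omega>\<bar>
            \<le> real T / (real T + real h) * d + (real h / (real T + real h))\<^sup>2 + \<epsilon>"
    if h: "h > max (max N1 N2) (max N3 N4)" and T: "T > max (max N1 N2) (max N3 N4)"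
      and d: "\<And>\<omega>. \<omega> \<in> \<Omega> \<Longrightarrow> \<bar>F (real T) \<omega> - G (real T + real h) \<omega>\<bar> \<le> d" and \<omega>: "\<omega> \<in> \<Omega>"
    for h T :: nat and d \<omega>
  proof -
    define s where "s = real T + real h"
    define c1 where "c1 = avg_aux_payoff K g (F (real T)) (real h) (real T)"
    define c2 where "c2 = disc_aux_payoff K g (G s) (real h) (1 / s)"
    \<comment> \<open>As \<open>s\<close> exceeds the positive integers \<open>N3\<close> and
      \<open>N4\<close>, the rate \<open>1 / s\<close> is small enough for both discounted
      inequalities.\<close>
    have s: "s > 0" "1 / s < 1 / real N3" "1 / s < 1 / real N4"
      using h T N3(1) N4(1) by (auto simp: s_def intro!: divide_strict_left_mono)
    have "c1 \<in> C" "F s \<omega> \<le> V c1 \<omega> + \<epsilon> / 2" "F s \<omega> \<ge> V c1 \<omega> - \<epsilon> / 2"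
      using N1[rule_format, of h T] N2[rule_format, of h T] h T \<omega> unfolding c1_def s_def by simp_all
    then have c1: "c1 \<in> C" "\<bar>F s \<omega> - V c1 \<omega>\<bar> \<le> \<epsilon> / 2" by linarith+
    have "c2 \<in> C" "G s \<omega> \<le> V c2 \<omega> + \<epsilon> / 2" "G s \<omega> \<ge> V c2 \<omega> - \<epsilon> / 2"
      using N3(2)[rule_format, of h "1 / s"] N4(2)[rule_format, of h "1 / s"] h s \<omega>
      unfolding c2_def G_def by simp_all
    then have c2: "c2 \<in> C" "\<bar>G s \<omega> - V c2 \<omega>\<bar> \<le> \<epsilon> / 2" by linarith+
    have G01: "G s \<omega>' \<in> {0..1}" if "\<omega>' \<in> \<Omega>" for \<omega>'
      unfolding G_def using s that
      by (intro game_value_unit[OF V C dC] disc_payoff_unit) auto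
    have "\<bar>V c1 \<omega> - V c2 \<omega>\<bar> \<le> real T / s * d + (real h / s)\<^sup>2"
      using h T G01 d unfolding c1_def c2_def s_def
      by (intro game_value_diff[OF V C c1(1)[unfolded c1_def] c2(1)[unfolded c2_def s_def] _ \<omega>]
          aux_payoffs_close) auto
    then show ?thesis using c1(2) c2(2) unfolding s_def by linarith
  qed
  then show ?thesis by blast
qed

end

section \<open>Transfer of uniform limits and conclusion\<close>

lemma uniform_limit_at_right_0_iff:
  fixes f :: "real \<Rightarrow> 'a \<Rightarrow> real"
  shows "uniform_limit X f L (at_right 0) \<longleftrightarrow> uniform_limit X (\<lambda>s. f (1 / s)) L at_top"
  by (simp add: uniform_limit_iff eventually_at_right_to_top inverse_eq_divide)

lemma uniform_limit_diff_zero: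
  fixes f h :: "'b \<Rightarrow> 'a \<Rightarrow> real"
  assumes "uniform_limit X f L A" "uniform_limit X (\<lambda>s x. f s x - h s x) (\<lambda>x. 0) A"
  shows "uniform_limit X h L A"
  using uniform_limit_minus[OF assms] by simp

theorem theorem2:
  fixes \<Omega> :: "'a set"
    and g :: "'a \<Rightarrow> real"
    and K :: "(real \<Rightarrow> 'a) set"
    and C :: "((real \<Rightarrow> 'a) \<Rightarrow> real) set"
    and V :: "((real \<Rightarrow> 'a) \<Rightarrow> real) \<Rightarrow> 'a \<Rightarrow> real"
  assumes "\<Omega> \<noteq> {}"
    and "g \<in> \<Omega> \<rightarrow> {0..1}"
    and "trajectory_class \<Omega> g K"
    and "payoff_class K C"
    and "game_value_map \<Omega> K C V"
    and "\<And>T. T > 0 \<Longrightarrow> avg_payoff K g T \<in> C"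
    and "\<And>l. l > 0 \<Longrightarrow> disc_payoff K g l \<in> C"
    and "avg_weak_DPP \<Omega> g K C V"
    and "disc_weak_DPP \<Omega> g K C V"
  shows "((\<exists>L. uniform_limit \<Omega> (\<lambda>T. V (avg_payoff K g T)) L at_top) \<longleftrightarrow>
          (\<exists>L. uniform_limit \<Omega> (\<lambda>l. V (disc_payoff K g l)) L (at_right 0))) \<and>
         ((\<exists>L. uniform_limit \<Omega> (\<lambda>T. V (avg_payoff K g T)) L at_top) \<or>
          (\<exists>L. uniform_limit \<Omega> (\<lambda>l. V (disc_payoff K g l)) L (at_right 0)) \<longrightarrow>
          (\<forall>\<omega>\<in>\<Omega>. \<exists>x. ((\<lambda>T. V (avg_payoff K g T) \<omega>) \<longlongrightarrow> x) at_top \<and>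
                       ((\<lambda>l. V (disc_payoff K g l) \<omega>) \<longlongrightarrow> x) (at_right 0)))"
proof -
  define F where "F = (\<lambda>s. V (avg_payoff K g s))"
  define G where "G = (\<lambda>s. V (disc_payoff K g (1 / s)))"
  note pre = assms(2,3)
  have unit: "F s \<omega> \<in> {0..1} \<and> G s \<omega> \<in> {0..1}" if "s > 0" "\<omega> \<in> \<Omega>" for s \<omega>
    unfolding F_def G_def using that
    by (intro conjI game_value_unit[OF assms(5,4)] assms(6,7)
        avg_payoff_unit[OF pre] disc_payoff_unit[OF pre]) auto
  have slow: "\<bar>F s \<omega> - F r \<omega>\<bar> \<le> (s - r) / s \<and> \<bar>G s \<omega> - G r \<omega>\<bar> \<le> (s - r) / s"
    if "0 < r" "r \<le> s" "\<omega> \<in> \<Omega>" for r s \<omega>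
    unfolding F_def G_def using that
    by (intro conjI game_value_diff[OF assms(5,4)] assms(6,7)
        avg_payoff_slow[OF pre] disc_payoff_slow[OF pre]) auto
  have close: "uniform_limit \<Omega> (\<lambda>s \<omega>. F s \<omega> - G s \<omega>) (\<lambda>_. 0) at_top"
    if "uniform_limit \<Omega> F L at_top \<or> uniform_limit \<Omega> G L at_top" for L
    by (rule coupled_families_uniformly_close[OF that unit slow])
      (use DPP_coupling[OF pre assms(4,5,7,8,9)] in \<open>unfold F_def G_def\<close>)
  \<comment> \<open>Fixing \<open>L\<close> on both sides, instead of quantifying it separately,
    gives the equivalence and the equality of the limits together.\<close>
  have same: "uniform_limit \<Omega> F L at_top \<longleftrightarrow> uniform_limit \<Omega> G L at_top" for L
  proof
    assume "uniform_limit \<Omega> F L at_top"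
    then show "uniform_limit \<Omega> G L at_top"
      using close uniform_limit_diff_zero by blast
  next
    assume G: "uniform_limit \<Omega> G L at_top"
    then have "uniform_limit \<Omega> (\<lambda>s \<omega>. G s \<omega> - F s \<omega>) (\<lambda>_. 0) at_top"
      using uniform_limit_uminus[OF close[of L]] by simp
    then show "uniform_limit \<Omega> F L at_top"
      using G uniform_limit_diff_zero by blast
  qed
  then have same': "uniform_limit \<Omega> (\<lambda>T. V (avg_payoff K g T)) L at_top \<longleftrightarrow>
      uniform_limit \<Omega> (\<lambda>l. V (disc_payoff K g l)) L (at_right 0)" for L
    unfolding uniform_limit_at_right_0_iff F_def G_def .
  then show ?thesis
    by (metis tendsto_uniform_limitI)
qed

end
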